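(* In $\tilde A_{q,p}$ ($p,q\ge 1$ coprime) and $\tilde D_N$ cluster algebras the cluster variables outside the frieze pattern given by the determinants $D^m_a(F_n)$ form friezes: the array whose rows are, for $m=0,1,\ldots,L$, the entries $D^m_a(F_n)$ (with $n$ running through an arithmetic progression of difference $a$; the row $m=0$ consists of $1$'s), arranged like brickwork with $D^{m}_a(F_{n})$ placed below and between $D^{m-1}_a(F_n)$ and $D^{m-1}_a(F_{n+a})$, is such that each diamond $$\begin{matrix} & \beta & \\ \alpha & & \delta\\ & \gamma & \end{matrix}$$ satisfies $\alpha\delta-\beta\gamma=1$; that is, for $1\le m\le L-1$ and all $n$ in the progression, $$D^m_a(F_n)\,D^m_a(F_{n+a})-D^{m-1}_a(F_{n+a})\,D^{m+1}_a(F_n)=1 .$$ In $\tilde A_{q,p}$ type there are two of these friezes, given by (i) the sequence $F=J$, with entries $J_{jp}$ ($j\in\mathbb Z$), $a=p$, $L=q-1$; (ii) the sequence $F=\tilde J$, with entries $\tilde J_{jq}$ ($j\in\mathbb Z$), $a=q$, $L=p-1$. In $\tilde D_N$ type the single frieze is given by $F=J'$, with entries $J'_j$ ($j\in\mathbb Z$), $a=1$, $L=N-3$.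
   Context: General. Cluster algebras are without coefficients or frozen variables. For an acyclic quiver with initial cluster variable $X^i_0$ at each vertex $i$, the frieze pattern is the family of cluster variables $X^i_n$ ($n\in\mathbb Z$) defined by $$X^i_nX^i_{n+1}=1+\Big(\prod_{j\to i}X^j_n\Big)\Big(\prod_{i\to j}X^j_{n+1}\Big),$$ with products over arrows of the quiver. For a sequence $F$, integer $a$ and $m\ge 0$, $D^m_a(F_n)$ is the determinant of the $m\times m$ tridiagonal matrix with diagonal entries $F_n,F_{n+a},\ldots,F_{n+(m-1)a}$ and all entries on the sub- and superdiagonal equal to $1$; $D^0_a(F_n)=1$. Type $\tilde A_{q,p}$. Let $N=p+q$. The quiver has vertices $0,1,\ldots,N-1$; its underlying graph is the cycle with consecutive vertices $0,p,2p,\ldots,(N-1)p$ modulo $N$, each edge oriented from the smaller label to the larger. With initial variables $x_i=X^i_0$, extend to $(x_n)_{n\in\mathbb Z}$ by $x_{n+p+q}x_n=x_{n+q}x_{n+p}+1$; then $X^i_n=x_{i-nN}$. Put $J_n:=\dfrac{x_{n+2p}+x_n}{x_{n+p}}$ and $\tilde J_n:=\dfrac{x_{n+2q}+x_n}{x_{n+q}}$ (periods $q$ and $p$ in $n$). Type $\tilde D_N$ ($N\ge4$). The quiver has vertices $1,\ldots,N+1$; its underlying graph has edges $1-3$, $2-3$, $i-(i+1)$ for $3\le i\le N-2$, $(N-1)-N$, $(N-1)-(N+1)$, with the bipartite orientation in which $3$ is a sink. Put $J'_n:=\dfrac{X^1_{n+1}+X^1_{n-1}}{X^2_n}$ (period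 $N-2$ in $n$). *)

theory Defs
  imports
    "HOL-Library.Poly_Mapping"
    "HOL-Computational_Algebra.Fraction_Field"
    "Graph_Theory.Digraph"
    "Jordan_Normal_Form.Determinant"
begin

text \<open>
  The ambient field: rational functions over the rationals in indeterminates \<open>indet i\<close>,
  one for each natural number \<open>i\<close>; a quiver uses those labelled by its vertices.
\<close>

type_synonym ratfun = "((nat \<Rightarrow>\<^sub>0 nat) \<Rightarrow>\<^sub>0 rat) fract"

definition indet :: "nat \<Rightarrow> ratfun" where
  "indet i = Fract (Poly_Mapping.single (Poly_Mapping.single i 1) 1) 1"

text \<open>
  A quiver is a directed multigraph.  The products range over arcs rather than over
  neighbouring vertices, so that parallel arrows contribute with multiplicity.
\<close>

definition frieze_pattern :: "(nat, 'e) pre_digraph \<Rightarrow> (nat \<Rightarrow> int \<Rightarrow> ratfun) \<Rightarrow> bool" where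
  "frieze_pattern Q X \<longleftrightarrow>
     (\<forall>i\<in>verts Q. X i 0 = indet i) \<and>
     (\<forall>i\<in>verts Q. \<forall>n.
        X i n * X i (n + 1) =
          1 + (\<Prod>e\<in>in_arcs Q i. X (tail Q e) n) * (\<Prod>e\<in>out_arcs Q i. X (head Q e) (n + 1)))"

definition tridiag_det :: "nat \<Rightarrow> int \<Rightarrow> (int \<Rightarrow> 'a::comm_ring_1) \<Rightarrow> int \<Rightarrow> 'a" where
  "tridiag_det m a F n =
     det (mat m m (\<lambda>(i, j).
       if i = j then F (n + int i * a)
       else if i = Suc j \<or> j = Suc i then 1
       else 0))"

lemma tridiag_det_0: "tridiag_det 0 a F n = 1"
  by (simp add: tridiag_det_def det_def)

text \<open>
  An array with rows \<open>0, \<dots>, L\<close>.  The entry \<open>A m j\<close> is placed below and between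
  \<open>A (m - 1) j\<close> and \<open>A (m - 1) (j + 1)\<close>, so that the diamond with left corner \<open>A m j\<close> has right
  corner \<open>A m (j + 1)\<close>, top \<open>A (m - 1) (j + 1)\<close> and bottom \<open>A (m + 1) j\<close>.
\<close>

definition is_frieze :: "nat \<Rightarrow> (nat \<Rightarrow> int \<Rightarrow> 'a::comm_ring_1) \<Rightarrow> bool" where
  "is_frieze L A \<longleftrightarrow>
     (\<forall>j. A 0 j = 1) \<and>
     (\<forall>m j. 1 \<le> m \<and> m + 1 \<le> L \<longrightarrow>
        A m j * A m (j + 1) - A (m - 1) (j + 1) * A (m + 1) j = 1)"

text \<open>
  Affine type A: arc \<open>k\<close> joins the consecutive vertices \<open>kp\<close> and \<open>(k + 1)p\<close> (modulo \<open>p + q\<close>) of the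
  cycle.  For \<open>p = q = 1\<close> this gives two parallel arrows, the Kronecker quiver.
\<close>

definition quiver_A :: "nat \<Rightarrow> nat \<Rightarrow> (nat, nat) pre_digraph" where
  "quiver_A q p =
     \<lparr>verts = {..<p + q},
      arcs = {..<p + q},
      tail = (\<lambda>k. min (k * p mod (p + q)) ((k + 1) * p mod (p + q))),
      head = (\<lambda>k. max (k * p mod (p + q)) ((k + 1) * p mod (p + q)))\<rparr>"

definition is_A_sequence ::
  "nat \<Rightarrow> nat \<Rightarrow> (nat \<Rightarrow> int \<Rightarrow> ratfun) \<Rightarrow> (int \<Rightarrow> ratfun) \<Rightarrow> bool" where
  "is_A_sequence q p X x \<longleftrightarrow>
     (\<forall>i<p + q. x (int i) = X i 0) \<and>
     (\<forall>n. x (n + int p + int q) * x n = x (n + int q) * x (n + int p) + 1)"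

text \<open>This is \<open>J\<close> for \<open>r = p\<close> and its counterpart J-tilde for \<open>r = q\<close>.\<close>

definition J_A :: "nat \<Rightarrow> (int \<Rightarrow> ratfun) \<Rightarrow> int \<Rightarrow> ratfun" where
  "J_A r x n = (x (n + 2 * int r) + x n) / x (n + int r)"

text \<open>
  Affine type D: \<open>level_D N i\<close> is the distance of the vertex \<open>i\<close> from the vertex \<open>3\<close>.  In the
  bipartite orientation with \<open>3\<close> a sink, the sinks are the vertices at even distance.
\<close>

definition level_D :: "nat \<Rightarrow> nat \<Rightarrow> nat" where
  "level_D N i = (if i \<le> 2 then 1 else if i \<le> N then i - 3 else N - 3)"

definition edges_D :: "nat \<Rightarrow> (nat \<times> nat) set" where
  "edges_D N =
     {(1, 3), (2, 3)} \<union> {(i, i + 1) |i. 3 \<le> i \<and> i + 2 \<le> N} \<union> {(N - 1, N), (N - 1, N + 1)}"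

definition quiver_D :: "nat \<Rightarrow> (nat, nat \<times> nat) pre_digraph" where
  "quiver_D N =
     \<lparr>verts = {1..N + 1},
      arcs = edges_D N,
      tail = (\<lambda>(i, j). if even (level_D N j) then i else j),
      head = (\<lambda>(i, j). if even (level_D N j) then j else i)\<rparr>"

definition J_D :: "(nat \<Rightarrow> int \<Rightarrow> ratfun) \<Rightarrow> int \<Rightarrow> ratfun" where
  "J_D X n = (X 1 (n + 1) + X 1 (n - 1)) / X 2 n"

end

theory Submission
  imports Defs
begin

lemma tridiag_det_1: "tridiag_det 1 a F n = F n"
  by (simp add: tridiag_det_def det_single)

text \<open>Laplace expansion along the first row, where only \<open>F n\<close> and a neighbouring
  1 can be nonzero. Removing a leading row and column moves the start of the sequence by
  \<open>a\<close>.\<close>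

lemma tridiag_det_Suc_Suc:
  "tridiag_det (Suc (Suc m)) a F n =
    F n * tridiag_det (Suc m) a F (n + a) - tridiag_det m a F (n + 2 * a)"
proof -
  define T where "T = (\<lambda>k n. mat k k (\<lambda>(i, j).
       if i = j then F (n + int i * a)
       else if i = Suc j \<or> j = Suc i then 1
       else 0))"
  have det_T: "det (T k l) = tridiag_det k a F l" for k l
    by (simp add: T_def tridiag_det_def)
  define A where "A = T (Suc (Suc m)) n"
  \<comment> \<open>The minor belonging to the superdiagonal 1. Its first column is a 1 on top of
    zeros, so one more expansion reduces it to size \<open>m\<close>.\<close>
  define B where "B = mat_delete A 0 1"
  have A: "A \<in> carrier_mat (Suc (Suc m)) (Suc (Suc m))"
    by (simp add: A_def T_def)
  have B: "B \<in> carrier_mat (Suc m) (Suc m)"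
    by (simp add: B_def A_def T_def mat_delete_def)
  have minor_A: "mat_delete A 0 0 = T (Suc m) (n + a)"
    by (rule eq_matI) (auto simp: A_def T_def mat_delete_def algebra_simps)
  have minor_B: "mat_delete B 0 0 = T m (n + 2 * a)"
    by (rule eq_matI) (auto simp: B_def A_def T_def mat_delete_def algebra_simps)
  have "det B = (\<Sum>i<Suc m. B $$ (i, 0) * cofactor B i 0)"
    using laplace_expansion_column[OF B, of 0] by simp
  also have "\<dots> = (\<Sum>i\<in>{0}. B $$ (i, 0) * cofactor B i 0)"
    by (rule sum.mono_neutral_right) (auto simp: B_def A_def T_def mat_delete_def)
  also have "\<dots> = det (T m (n + 2 * a))"
    by (simp add: cofactor_def minor_B) (simp add: B_def A_def T_def mat_delete_def)
  finally have det_B: "det B = tridiag_det m a F (n + 2 * a)"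
    by (simp add: det_T)
  have "det A = (\<Sum>j<Suc (Suc m). A $$ (0, j) * cofactor A 0 j)"
    using laplace_expansion_row[OF A, of 0] by simp
  also have "\<dots> = (\<Sum>j\<in>{0, 1}. A $$ (0, j) * cofactor A 0 j)"
    by (rule sum.mono_neutral_right) (auto simp: A_def T_def)
  \<comment> \<open>The minus sign is the cofactor sign at position (0, 1).\<close>
  also have "\<dots> = F n * det (T (Suc m) (n + a)) - det B"
    by (simp add: cofactor_def minor_A B_def) (simp add: A_def T_def)
  finally show ?thesis
    by (simp add: A_def det_T det_B)
qed

text \<open>Expanding both factors that start at \<open>n\<close> cancels the terms containing \<open>F n\<close> and leaves the
  diamond with \<open>m\<close> lowered by one and \<open>n\<close> shifted by \<open>a\<close>.\<close>

lemma tridiag_det_diamond: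
  "tridiag_det (Suc m) a F n * tridiag_det (Suc m) a F (n + a)
    - tridiag_det m a F (n + a) * tridiag_det (Suc (Suc m)) a F n = 1"
proof (induction m arbitrary: n)
  case 0
  show ?case
    using tridiag_det_1[of a F] by (simp add: tridiag_det_Suc_Suc tridiag_det_0)
next
  case (Suc m)
  \<comment> \<open>The induction hypothesis at \<open>n + a\<close> has its right corner at
    \<open>n + a + a\<close>, the recursion writes \<open>n + 2 * a\<close>.\<close>
  have "n + a + a = n + 2 * a"
    by simp
  then show ?case
    using Suc.IH[of "n + a"]
    unfolding tridiag_det_Suc_Suc[of "Suc m" a F n] tridiag_det_Suc_Suc[of m a F n]
    by (simp add: algebra_simps)
qed

text \<open>Column \<open>j\<close> starts at \<open>j * a\<close>, so a step to the right in a row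
  is a shift by \<open>a\<close> and each diamond is an instance of
  \<open>tridiag_det_diamond\<close>.\<close>

lemma is_frieze_tridiag_det: "is_frieze L (\<lambda>m j. tridiag_det m a F (j * a))"
  unfolding is_frieze_def
proof (intro conjI allI impI)
  fix m :: nat and j :: int
  assume "1 \<le> m \<and> m + 1 \<le> L"
  then obtain k where "m = Suc k"
    by (cases m) auto
  then show "tridiag_det m a F (j * a) * tridiag_det m a F ((j + 1) * a)
      - tridiag_det (m - 1) a F ((j + 1) * a) * tridiag_det (m + 1) a F (j * a) = 1"
    using tridiag_det_diamond[of k a F "j * a"] by (simp add: distrib_right)
qed (simp add: tridiag_det_0)

theorem proposition1p5:
  shows
    "(\<forall>(p::nat) (q::nat) X x.
        1 \<le> p \<and> 1 \<le> q \<and> coprime p q \<and>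
        frieze_pattern (quiver_A q p) X \<and> is_A_sequence q p X x \<longrightarrow>
          is_frieze (q - 1) (\<lambda>m j. tridiag_det m (int p) (J_A p x) (j * int p)) \<and>
          is_frieze (p - 1) (\<lambda>m j. tridiag_det m (int q) (J_A q x) (j * int q)))
     \<and>
     (\<forall>(N::nat) X.
        4 \<le> N \<and> frieze_pattern (quiver_D N) X \<longrightarrow>
          is_frieze (N - 3) (\<lambda>m j. tridiag_det m 1 (J_D X) j))"
  \<comment> \<open>Type D has \<open>a = 1\<close>; simplifying that instance turns
    \<open>j * 1\<close> into the plain index \<open>j\<close>.\<close>
  by (simp add: is_frieze_tridiag_det is_frieze_tridiag_det[where a = 1, simplified])

end
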